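(* For every tree $T$, $\chi_{\mathrm{cen}}(T)\leq c\cdot\chi_{\mathrm{lin}}(T)$, where $c=\alpha\log 3<3.7$ and $\alpha=\log 3/\log\left(\frac{1+\sqrt5}{2}\right)$.
   Context: Logarithms are binary. A centered coloring of a graph $G$ assigns integers (colors) to vertices so that every connected subgraph contains a vertex whose color is unique in that subgraph; $\chi_{\mathrm{cen}}(G)$ is the minimum number of colors of such a coloring. A linear coloring requires the same only for every path of $G$ (as a subgraph); $\chi_{\mathrm{lin}}(G)$ is the minimum number of colors of a linear coloring. *)

theory Defs
  imports Complex_Main "Graph_Theory.Digraph_Component"
begin

text \<open>
  Finite simple graphs are modelled by \<^locale>\<open>pair_graph\<close>: an undirected edge $uv$ is the pair of
  opposite arcs $(u,v)$ and $(v,u)$. In this encoding every edge is a directed cycle of length 2,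
  so \<^const>\<open>tree\<close> (no directed cycle at all) does not describe undirected trees; the
  undirected cycles are exactly the directed cycles of length at least 3.
\<close>

definition undirected_tree :: "'a pair_pre_digraph \<Rightarrow> bool" where
  "undirected_tree T \<longleftrightarrow>
     pair_graph T \<and> connected T \<and> \<not> (\<exists>p. pre_digraph.cycle T p \<and> 3 \<le> length p)"

definition has_unique_color :: "('a \<Rightarrow> int) \<Rightarrow> 'a set \<Rightarrow> bool" where
  "has_unique_color f S \<longleftrightarrow> (\<exists>v\<in>S. \<forall>w\<in>S. f w = f v \<longrightarrow> w = v)"

definition centered_coloring :: "'a pair_pre_digraph \<Rightarrow> ('a \<Rightarrow> int) \<Rightarrow> bool" where
  "centered_coloring G f \<longleftrightarrow>
     (\<forall>H :: 'a pair_pre_digraph.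
        pair_graph H \<and> subgraph H G \<and> connected H \<longrightarrow> has_unique_color f (pverts H))"

definition linear_coloring :: "'a pair_pre_digraph \<Rightarrow> ('a \<Rightarrow> int) \<Rightarrow> bool" where
  "linear_coloring G f \<longleftrightarrow>
     (\<forall>u p v. pre_digraph.apath G u p v \<longrightarrow>
        has_unique_color f (set (pre_digraph.awalk_verts G u p)))"

definition chi_cen :: "'a pair_pre_digraph \<Rightarrow> nat" where
  "chi_cen G = (LEAST k. \<exists>f. centered_coloring G f \<and> card (f ` pverts G) = k)"

definition chi_lin :: "'a pair_pre_digraph \<Rightarrow> nat" where
  "chi_lin G = (LEAST k. \<exists>f. linear_coloring G f \<and> card (f ` pverts G) = k)"

definition alpha :: real where
  "alpha = log 2 3 / log 2 ((1 + sqrt 5) / 2)"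

definition c_tree :: real where
  "c_tree = alpha * log 2 3"

end

theory Submission
  imports Defs "HOL-Library.Tree" "HOL-Library.FuncSet"
begin

text \<open>
  In a tree rooted at \<open>r\<close>, choose at every vertex the two children that admit the largest binary
  subtrees; this yields a binary subtree at \<open>r\<close>, of size \<open>N\<close> say. Following the heavier child from
  \<open>r\<close> gives a spine whose vertices, weighted by one plus the size of the second best branch, have
  total weight \<open>N\<close>. Eliminating the spine by repeatedly removing a weighted median, and then
  recursing into the branches, produces a centered coloring with at most \<open>2 log (N + 1)\<close> colors.

  Conversely, let \<open>f\<close> be a linear coloring with \<open>k\<close> colors. Label the \<open>N + 1\<close> leaf positions of the
  binary subtree by vectors in \<open>{0, 1, 2}\<^sup>k\<close>, where passing a vertex \<open>x\<close> changes the coordinate \<open>f x\<close>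
  by 1 or by 2 modulo 3 according to the direction taken. The path joining two leaf positions has a
  uniquely colored vertex, and in the coordinate of its color the two labels differ. Hence
  \<open>N + 1 \<le> 3\<^sup>k\<close>, so \<open>2 k log 3\<close> colors suffice, and \<open>2 \<le> alpha\<close> because \<open>3\<close> exceeds the square of
  the golden ratio.
\<close>

section \<open>Vertex rankings and their composition\<close>

section \<open>Vertex rankings and weighted chains\<close>

definition connected_set :: "('a \<times> 'a) set \<Rightarrow> 'a set \<Rightarrow> bool" where
  "connected_set E W \<longleftrightarrow> W \<noteq> {} \<and> (\<forall>x\<in>W. \<forall>y\<in>W. (x, y) \<in> (E \<inter> W \<times> W)\<^sup>*)"

text \<open>A vertex ranking: the largest value on every connected set occurs once. This asks more
  than a centered coloring does, but it suits recursion, because a deleted vertex can be given a new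
  top value.\<close>

definition rankable :: "('a \<times> 'a) set \<Rightarrow> 'a set \<Rightarrow> nat \<Rightarrow> bool" where
  "rankable E V n \<longleftrightarrow>
     (\<exists>f :: 'a \<Rightarrow> nat. (\<forall>v\<in>V. f v < n) \<and>
        (\<forall>W. W \<subseteq> V \<and> connected_set E W \<longrightarrow> (\<exists>v\<in>W. \<forall>w\<in>W. w \<noteq> v \<longrightarrow> f w < f v)))"

lemma rankable_empty: "rankable E {} n"
  unfolding rankable_def connected_set_def by auto

text \<open>The vertex \<open>v\<close> receives the fresh top value \<open>n\<close>, so it
  dominates every connected set through it; all other connected sets lie in
  \<open>V - {v}\<close>.\<close>

lemma rankable_insert:
  assumes "rankable E (V - {v}) n"
  shows "rankable E V (Suc n)"
proof -
  obtain f where f: "\<forall>x\<in>V - {v}. f x < n"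
    and uniq: "\<forall>W. W \<subseteq> V - {v} \<and> connected_set E W \<longrightarrow> (\<exists>x\<in>W. \<forall>w\<in>W. w \<noteq> x \<longrightarrow> f w < f x)"
    using assms unfolding rankable_def by (elim exE conjE)
  let ?g = "f(v := n)"
  have "\<exists>x\<in>W. \<forall>w\<in>W. w \<noteq> x \<longrightarrow> ?g w < ?g x" if W: "W \<subseteq> V" "connected_set E W" for W
  proof (cases "v \<in> W")
    case True
    with W f show ?thesis by (intro bexI[of _ v]) auto
  next
    case False
    with W have "W \<subseteq> V - {v}" by auto
    then obtain x where "x \<in> W" "\<forall>w\<in>W. w \<noteq> x \<longrightarrow> f w < f x" using uniq W(2) by blast
    with False show ?thesis by (intro bexI[of _ x]) auto
  qed
  moreover have "\<forall>x\<in>V. ?g x < Suc n" using f by (auto simp: less_Suc_eq)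
  ultimately show ?thesis unfolding rankable_def by (intro exI[of _ ?g]) simp
qed

lemma connected_set_closed_subset:
  assumes "connected_set E W" "x \<in> W" "x \<in> A"
    and closed: "\<And>y z. y \<in> A \<inter> W \<Longrightarrow> z \<in> W \<Longrightarrow> (y, z) \<in> E \<Longrightarrow> z \<in> A"
  shows "W \<subseteq> A"
proof
  fix y assume "y \<in> W"
  with assms have "(x, y) \<in> (E \<inter> W \<times> W)\<^sup>*" unfolding connected_set_def by blast
  then show "y \<in> A" by induction (use assms closed in auto)
qed

text \<open>With no edges between different parts, a connected set stays inside one part, so all
  parts can share the same \<open>n\<close> values.\<close>

lemma rankable_UN:
  assumes rank: "\<And>i. i \<in> I \<Longrightarrow> rankable E (A i) n"
    and disj: "\<And>i j. i \<in> I \<Longrightarrow> j \<in> I \<Longrightarrow> i \<noteq> j \<Longrightarrow> A i \<inter> A j = {}"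
    and sep: "\<And>i j x y. i \<in> I \<Longrightarrow> j \<in> I \<Longrightarrow> i \<noteq> j \<Longrightarrow> x \<in> A i \<Longrightarrow> y \<in> A j \<Longrightarrow> (x, y) \<notin> E"
  shows "rankable E (\<Union>i\<in>I. A i) n"
proof -
  have "\<forall>i\<in>I. \<exists>f. (\<forall>v\<in>A i. f v < n) \<and>
      (\<forall>W. W \<subseteq> A i \<and> connected_set E W \<longrightarrow> (\<exists>v\<in>W. \<forall>w\<in>W. w \<noteq> v \<longrightarrow> f w < f v))"
    using rank unfolding rankable_def by blast
  then obtain F where F: "\<And>i v. i \<in> I \<Longrightarrow> v \<in> A i \<Longrightarrow> F i v < n"
    and uniq: "\<And>i W. i \<in> I \<Longrightarrow> W \<subseteq> A i \<Longrightarrow> connected_set E W \<Longrightarrow>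
        \<exists>v\<in>W. \<forall>w\<in>W. w \<noteq> v \<longrightarrow> F i w < F i v"
    by metis
  \<comment> \<open>Disjointness of the parts makes the chosen index the only possible one.\<close>
  define g where "g v = F (SOME i. i \<in> I \<and> v \<in> A i) v" for v
  have g: "g v = F i v" if "i \<in> I" "v \<in> A i" for i v
  proof -
    have "(SOME j. j \<in> I \<and> v \<in> A j) = i"
      using that disj by (intro some_equality) blast+
    then show ?thesis by (simp add: g_def)
  qed
  have "\<exists>v\<in>W. \<forall>w\<in>W. w \<noteq> v \<longrightarrow> g w < g v"
    if W: "W \<subseteq> (\<Union>i\<in>I. A i)" "connected_set E W" for W
  proof -
    obtain x where "x \<in> W" using W(2) unfolding connected_set_def by blast
    then obtain i where i: "i \<in> I" "x \<in> A i" using W by blast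
    have "z \<in> A i" if "y \<in> A i \<inter> W" "z \<in> W" "(y, z) \<in> E" for y z
    proof -
      obtain j where "j \<in> I" "z \<in> A j" using W(1) \<open>z \<in> W\<close> by blast
      then show ?thesis using sep[of i j y z] i that by blast
    qed
    then have "W \<subseteq> A i"
      using connected_set_closed_subset[OF W(2) \<open>x \<in> W\<close> i(2)] by blast
    with uniq[OF i(1) this W(2)] show ?thesis using g[OF i(1)] by (metis subsetD)
  qed
  moreover have "\<forall>v\<in>(\<Union>i\<in>I. A i). g v < n" using F g by fastforce
  ultimately show ?thesis unfolding rankable_def by blast
qed

lemma rankable_Un:
  assumes "rankable E A n" "rankable E B n" "A \<inter> B = {}"
    and "\<And>x y. x \<in> A \<Longrightarrow> y \<in> B \<Longrightarrow> (x, y) \<notin> E \<and> (y, x) \<notin> E"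
  shows "rankable E (A \<union> B) n"
proof -
  have "rankable E (\<Union>i\<in>UNIV. if i then A else B) n"
    using assms by (intro rankable_UN) (auto split: if_splits)
  moreover have "(\<Union>i\<in>UNIV. if i then A else B) = A \<union> B" by (auto split: if_splits)
  ultimately show ?thesis by simp
qed

section \<open>Chains along a spine and their elimination by weighted medians\<close>

text \<open>
  In an entry \<open>(v, A, w)\<close> of a chain, \<open>v\<close> is a vertex of the spine, \<open>A\<close> consists of \<open>v\<close> and the
  branches hanging off the spine at \<open>v\<close>, and \<open>w\<close> is a weight.
\<close>

definition chain_verts :: "('a \<times> 'a set \<times> nat) list \<Rightarrow> 'a set" where
  "chain_verts ds = (\<Union>(v, A, w)\<in>set ds. A)"

definition chain_weight :: "('a \<times> 'a set \<times> nat) list \<Rightarrow> nat" where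
  "chain_weight ds = (\<Sum>(v, A, w)\<leftarrow>ds. w)"

text \<open>A block is joined to the later blocks only by the spine edge to the next block. For the
  last block \<open>hd ds\<close> is arbitrary, but then \<open>chain_verts ds\<close> is empty.
  Only edges towards later blocks are restricted; symmetry of \<open>E\<close> handles the reverse
  ones.\<close>

fun chain :: "('a \<times> 'a) set \<Rightarrow> ('a \<times> 'a set \<times> nat) list \<Rightarrow> bool" where
  "chain E [] \<longleftrightarrow> True"
| "chain E ((v, A, w) # ds) \<longleftrightarrow>
     v \<in> A \<and> A \<inter> chain_verts ds = {} \<and>
     (\<forall>x\<in>A. \<forall>y\<in>chain_verts ds. (x, y) \<in> E \<longrightarrow> x = v \<and> y = fst (hd ds)) \<and> chain E ds"

lemma chain_simps [simp]:
  "chain_verts [] = {}"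
  "chain_verts ((v, A, w) # ds) = A \<union> chain_verts ds"
  "chain_verts (ds @ es) = chain_verts ds \<union> chain_verts es"
  "chain_weight [] = 0"
  "chain_weight ((v, A, w) # ds) = w + chain_weight ds"
  "chain_weight (ds @ es) = chain_weight ds + chain_weight es"
  by (auto simp: chain_verts_def chain_weight_def)

lemma chain_hd_mem: "chain E ds \<Longrightarrow> ds \<noteq> [] \<Longrightarrow> fst (hd ds) \<in> chain_verts ds"
  by (cases ds) auto

text \<open>Deleting \<open>v\<close> separates the chain before it, the rest of its own block and
  the chain after it: every edge between these pieces has \<open>v\<close> as an end.\<close>

lemma chain_split:
  assumes "chain E (xs @ (v, A, w) # ys)"
  shows "chain E xs" "chain E ys" "v \<in> A"
    "chain_verts xs \<inter> A = {}" "chain_verts xs \<inter> chain_verts ys = {}" "A \<inter> chain_verts ys = {}"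
    "\<And>x y. x \<in> chain_verts xs \<Longrightarrow> y \<in> A \<union> chain_verts ys \<Longrightarrow> (x, y) \<in> E \<Longrightarrow> y = v"
    "\<And>x y. x \<in> A \<Longrightarrow> y \<in> chain_verts ys \<Longrightarrow> (x, y) \<in> E \<Longrightarrow> x = v"
proof -
  have "chain E xs \<and> chain E ys \<and> v \<in> A \<and>
    chain_verts xs \<inter> A = {} \<and> chain_verts xs \<inter> chain_verts ys = {} \<and> A \<inter> chain_verts ys = {} \<and>
    (\<forall>x\<in>chain_verts xs. \<forall>y\<in>A \<union> chain_verts ys. (x, y) \<in> E \<longrightarrow> y = v) \<and>
    (\<forall>x\<in>A. \<forall>y\<in>chain_verts ys. (x, y) \<in> E \<longrightarrow> x = v)"
    using assms
  proof (induction xs)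
    case Nil
    then show ?case by auto
  next
    case (Cons d xs)
    obtain u B w' where d: "d = (u, B, w')" by (cases d)
    let ?zs = "xs @ (v, A, w) # ys"
    have ch: "chain E ?zs"
      and dis: "u \<in> B" "B \<inter> chain_verts ?zs = {}"
      and edge: "\<And>x y. x \<in> B \<Longrightarrow> y \<in> chain_verts ?zs \<Longrightarrow> (x, y) \<in> E \<Longrightarrow> x = u \<and> y = fst (hd ?zs)"
      using Cons.prems d by auto
    note IH = Cons.IH[OF ch]
    have hd: "xs \<noteq> [] \<Longrightarrow> hd ?zs = hd xs" "xs \<noteq> [] \<Longrightarrow> fst (hd xs) \<in> chain_verts xs"
      "xs = [] \<Longrightarrow> fst (hd ?zs) = v"
      using IH chain_hd_mem[of E xs] by auto
    have "y = v" if "x \<in> B" "y \<in> A \<union> chain_verts ys" "(x, y) \<in> E" for x y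
    proof (cases "xs = []")
      case True
      then show ?thesis using edge[of x y] that hd(3) by auto
    next
      case False
      then have "y \<in> chain_verts xs" using edge[of x y] that hd by auto
      then show ?thesis using that IH by blast
    qed
    moreover have "chain E (d # xs)"
    proof -
      have "x = u \<and> y = fst (hd xs)" if "x \<in> B" "y \<in> chain_verts xs" "(x, y) \<in> E" for x y
      proof -
        have "xs \<noteq> []" using that by auto
        then show ?thesis using edge[of x y] that hd by auto
      qed
      then show ?thesis using dis IH d by auto
    qed
    ultimately show ?case using IH dis d by auto
  qed
  then show "chain E xs" "chain E ys" "v \<in> A"
    "chain_verts xs \<inter> A = {}" "chain_verts xs \<inter> chain_verts ys = {}" "A \<inter> chain_verts ys = {}"
    "\<And>x y. x \<in> chain_verts xs \<Longrightarrow> y \<in> A \<union> chain_verts ys \<Longrightarrow> (x, y) \<in> E \<Longrightarrow> y = v"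
    "\<And>x y. x \<in> A \<Longrightarrow> y \<in> chain_verts ys \<Longrightarrow> (x, y) \<in> E \<Longrightarrow> x = v"
    by blast+
qed

lemma weighted_median:
  assumes "ds \<noteq> []"
  obtains xs v A w ys where "ds = xs @ (v, A, w) # ys"
    "2 * chain_weight xs \<le> chain_weight ds" "2 * chain_weight ys \<le> chain_weight ds"
proof -
  \<comment> \<open>The threshold \<open>M\<close> makes the induction work: passing an entry of
    weight \<open>w\<close> lowers it by \<open>2 * w\<close>. Starting at
    \<open>M = chain_weight ds\<close> gives both halves.\<close>
  have "\<exists>xs v A w ys. ds = xs @ (v, A, w) # ys \<and>
      2 * chain_weight xs \<le> M \<and> 2 * chain_weight ys + M \<le> 2 * chain_weight ds"
    if "M \<le> 2 * chain_weight ds" for M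
    using assms that
  proof (induction ds arbitrary: M)
    case (Cons d ds)
    obtain v A w where d: "d = (v, A, w)" by (cases d)
    show ?case
    proof (cases "ds = [] \<or> M \<le> 2 * w")
      case True
      then show ?thesis using Cons.prems d
        by (intro exI[of _ "[]"] exI[of _ v] exI[of _ A] exI[of _ w] exI[of _ ds]) auto
    next
      case False
      have M: "M - 2 * w \<le> 2 * chain_weight ds" using Cons.prems d by auto
      from False obtain xs v' A' w' ys where "ds = xs @ (v', A', w') # ys"
        "2 * chain_weight xs \<le> M - 2 * w"
        "2 * chain_weight ys + (M - 2 * w) \<le> 2 * chain_weight ds"
        using Cons.IH[OF _ M] by blast
      with False d show ?thesis
        by (intro exI[of _ "d # xs"] exI[of _ v'] exI[of _ A'] exI[of _ w'] exI[of _ ys]) auto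
    qed
  qed simp
  from this[of "chain_weight ds"] that show thesis by auto
qed

text \<open>Here \<open>j\<close> counts the medians already removed; each removal halves the weight
  and spends one of \<open>n\<close> values. The assumption on entries says that a block light
  enough to be met at depth \<open>i\<close> can be finished with the values left after its spine
  vertex is removed.\<close>

lemma rankable_subchain:
  assumes "sym E" "chain E ds"
    and "2 ^ j * chain_weight ds \<le> N"
    and "\<And>v A w i. (v, A, w) \<in> set ds \<Longrightarrow> 2 ^ i * w \<le> N \<Longrightarrow>
           Suc i \<le> n \<and> rankable E (A - {v}) (n - Suc i)"
  shows "rankable E (chain_verts ds) (n - j)"
  using assms(2-)
proof (induction "length ds" arbitrary: ds j rule: less_induct)
  case less
  show ?case
  proof (cases "ds = []")
    case True
    then show ?thesis by (simp add: rankable_empty)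
  next
    case False
    then obtain xs v A w ys where ds: "ds = xs @ (v, A, w) # ys"
      and half: "2 * chain_weight xs \<le> chain_weight ds" "2 * chain_weight ys \<le> chain_weight ds"
      by (rule weighted_median)
    note split = chain_split[OF less.prems(1)[unfolded ds]]
    have "2 ^ Suc j * a \<le> N" if "2 * a \<le> chain_weight ds" for a
    proof -
      have "2 ^ Suc j * a = 2 ^ j * (2 * a)" by simp
      also have "\<dots> \<le> 2 ^ j * chain_weight ds" using that by (rule mult_le_mono2)
      finally show ?thesis using less.prems(2) by linarith
    qed
    note halves = this[OF half(1)] this[OF half(2)]
    have xs: "rankable E (chain_verts xs) (n - Suc j)"
      using ds less.prems(3) by (intro less.hyps[OF _ split(1) halves(1)]) auto
    have ys: "rankable E (chain_verts ys) (n - Suc j)"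
      using ds less.prems(3) by (intro less.hyps[OF _ split(2) halves(2)]) auto
    \<comment> \<open>The median block weighs at most as much as the current chain, so the
      assumption on entries applies to it at depth \<open>j\<close>.\<close>
    have "2 ^ j * w \<le> N"
      using less.prems(2) ds by (simp add: distrib_left)
    then have A: "Suc j \<le> n" "rankable E (A - {v}) (n - Suc j)"
      using less.prems(3)[of v A w j] ds by auto
    have symE: "(x, y) \<in> E \<longleftrightarrow> (y, x) \<in> E" for x y
      using \<open>sym E\<close> by (auto dest: symD)
    have v: "v \<notin> chain_verts xs" "v \<notin> chain_verts ys" using split(3-6) by auto
    have "rankable E ((chain_verts xs \<union> (A - {v})) \<union> chain_verts ys) (n - Suc j)"
    proof (intro rankable_Un xs ys A(2))
      show "chain_verts xs \<inter> (A - {v}) = {}" using split(4) by auto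
      show "(chain_verts xs \<union> (A - {v})) \<inter> chain_verts ys = {}" using split(5,6) by auto
      show "(x, y) \<notin> E \<and> (y, x) \<notin> E" if "x \<in> chain_verts xs" "y \<in> A - {v}" for x y
        using split(7)[of x y] that symE[of x y] by auto
      show "(x, y) \<notin> E \<and> (y, x) \<notin> E"
        if "x \<in> chain_verts xs \<union> (A - {v})" "y \<in> chain_verts ys" for x y
        using split(7)[of x y] split(8)[of x y] that symE[of x y] v by auto
    qed
    also have "(chain_verts xs \<union> (A - {v})) \<union> chain_verts ys = chain_verts ds - {v}"
      using v ds by auto
    finally have "rankable E (chain_verts ds) (Suc (n - Suc j))" by (rule rankable_insert)
    with A(1) show ?thesis by (simp add: Suc_diff_Suc)
  qed
qed

text \<open>For \<open>w > 0\<close> this says that \<open>\<lfloor>2 log w\<rfloor>\<close> ranks suffice for \<open>V\<close>.\<close>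

definition quadratically_rankable :: "('a \<times> 'a) set \<Rightarrow> 'a set \<Rightarrow> nat \<Rightarrow> bool" where
  "quadratically_rankable E V w \<longleftrightarrow> (\<forall>n. w\<^sup>2 < 2 ^ Suc n \<longrightarrow> rankable E V n)"

lemma quadratically_rankable_mono:
  assumes "quadratically_rankable E V w" "w \<le> w'"
  shows "quadratically_rankable E V w'"
  using assms unfolding quadratically_rankable_def by (meson le_less_trans power2_nat_le_eq_le)

text \<open>A block met at depth \<open>i \<ge> 1\<close> satisfies
  \<open>2 ^ i * w \<le> N\<close>; squaring frees \<open>2 * i\<close> values, enough to pay for
  the \<open>i + 1\<close> spine vertices removed so far.\<close>

lemma quadratically_rankable_chain:
  assumes "sym E" "chain E ds"
    and entries: "\<And>v A w. (v, A, w) \<in> set ds \<Longrightarrow>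
           0 < w \<and> 2 * w \<le> Suc (chain_weight ds) \<and> quadratically_rankable E (A - {v}) w"
  shows "quadratically_rankable E (chain_verts ds) (Suc (chain_weight ds))"
  unfolding quadratically_rankable_def
proof (intro allI impI)
  fix n
  let ?N = "chain_weight ds"
  assume n: "(Suc ?N)\<^sup>2 < 2 ^ Suc n"
  have "Suc i \<le> n \<and> rankable E (A - {v}) (n - Suc i)"
    if mem: "(v, A, w) \<in> set ds" and w: "2 ^ i * w \<le> ?N" for v A w i
  proof -
    \<comment> \<open>At depth 0 squaring frees nothing although one value is spent; there the
      assumption \<open>2 * w \<le> N + 1\<close> supplies a factor 2. Thus \<open>k\<close>
      satisfies \<open>2 * k \<ge> i + 1\<close> in all cases.\<close>
    define k where "k = max 1 i"
    have "2 ^ k * w \<le> Suc ?N"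
      using w entries[OF mem] by (cases i) (auto simp: k_def)
    then have "(2 ^ k * w)\<^sup>2 \<le> (Suc ?N)\<^sup>2" by (rule power_mono) simp
    also note n
    finally have less: "2 ^ (2 * k) * w\<^sup>2 < 2 ^ Suc n"
      by (simp add: power_mult_distrib power_mult[symmetric] mult.commute)
    \<comment> \<open>Positivity of \<open>w\<close> gives \<open>2 * k \<le> n\<close>, so the
      subtraction \<open>n - Suc i\<close> is not truncated.\<close>
    moreover have "2 ^ (2 * k) * 1 \<le> 2 ^ (2 * k) * w\<^sup>2"
      using entries[OF mem] by (intro mult_le_mono2) auto
    ultimately have "(2::nat) ^ (2 * k) < 2 ^ Suc n" by linarith
    then have k: "2 * k < Suc n" by (simp only: power_strict_increasing_iff)
    then have i: "Suc i \<le> n" "n - i + 2 * k \<ge> Suc n" by (auto simp: k_def)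
    have "2 ^ (2 * k) * w\<^sup>2 < 2 ^ (2 * k) * 2 ^ (n - i)"
    proof -
      have "(2::nat) ^ Suc n \<le> 2 ^ (2 * k + (n - i))" using i by (intro power_increasing) auto
      with less show ?thesis by (simp only: power_add)
    qed
    then have "w\<^sup>2 < 2 ^ Suc (n - Suc i)" using i by (simp add: Suc_diff_Suc)
    then show ?thesis using i(1) entries[OF mem] unfolding quadratically_rankable_def by blast
  qed
  then have "rankable E (chain_verts ds) (n - 0)"
    using assms by (intro rankable_subchain[where N = ?N]) auto
  then show "rankable E (chain_verts ds) n" by simp
qed

section \<open>Binary subtrees and the paths inside them\<close>

section \<open>Binary subtrees and linear colorings\<close>

definition simple_path :: "('a \<times> 'a) set \<Rightarrow> 'a list \<Rightarrow> bool" where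
  "simple_path E p \<longleftrightarrow> p \<noteq> [] \<and> distinct p \<and> successively (\<lambda>x y. (x, y) \<in> E) p"

text \<open>Set-valued, so that an empty child imposes no edge condition in
  \<open>binary_subtree\<close>.\<close>

fun roots :: "'a tree \<Rightarrow> 'a set" where
  "roots \<langle>\<rangle> = {}"
| "roots \<langle>l, x, r\<rangle> = {x}"

fun binary_subtree :: "('a \<times> 'a) set \<Rightarrow> 'a tree \<Rightarrow> bool" where
  "binary_subtree E \<langle>\<rangle> \<longleftrightarrow> True"
| "binary_subtree E \<langle>l, x, r\<rangle> \<longleftrightarrow>
     x \<notin> set_tree l \<union> set_tree r \<and> set_tree l \<inter> set_tree r = {} \<and>
     (\<forall>y\<in>roots l \<union> roots r. (x, y) \<in> E) \<and> binary_subtree E l \<and> binary_subtree E r"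

text \<open>The vertices passed on the way to a leaf position. Both positions below a node with two
  empty children yield the same list, so positions are counted by their codes instead.\<close>

fun root_paths :: "'a tree \<Rightarrow> 'a list set" where
  "root_paths \<langle>\<rangle> = {[]}"
| "root_paths \<langle>l, x, r\<rangle> = Cons x ` (root_paths l \<union> root_paths r)"

lemma root_pathsD:
  assumes "binary_subtree E t" "p \<in> root_paths t"
  shows "distinct p" "successively (\<lambda>x y. (x, y) \<in> E) p" "set p \<subseteq> set_tree t"
    "p \<noteq> [] \<Longrightarrow> hd p \<in> roots t"
proof -
  have "distinct p \<and> successively (\<lambda>x y. (x, y) \<in> E) p \<and> set p \<subseteq> set_tree t \<and>
      (p \<noteq> [] \<longrightarrow> hd p \<in> roots t)"
    using assms
  proof (induction t arbitrary: p)
    case (Node l x r)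
    then obtain q where p: "p = x # q" "q \<in> root_paths l \<union> root_paths r" by auto
    have "distinct q \<and> successively (\<lambda>x y. (x, y) \<in> E) q \<and> set q \<subseteq> set_tree l \<union> set_tree r \<and>
        (q \<noteq> [] \<longrightarrow> hd q \<in> roots l \<union> roots r)"
      using p(2) Node.IH[of q] Node.prems(1) by fastforce
    then show ?case using p Node.prems(1) by (auto simp: successively_Cons)
  qed simp
  then show "distinct p" "successively (\<lambda>x y. (x, y) \<in> E) p" "set p \<subseteq> set_tree t"
    "p \<noteq> [] \<Longrightarrow> hd p \<in> roots t"
    by auto
qed

lemma simple_path_through_root:
  assumes "sym E" "binary_subtree E \<langle>l, x, r\<rangle>" "p \<in> root_paths l" "q \<in> root_paths r"
  shows "simple_path E (rev p @ x # q)"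
proof -
  have p: "distinct p" "successively (\<lambda>x y. (x, y) \<in> E) p" "set p \<subseteq> set_tree l"
      "p \<noteq> [] \<Longrightarrow> hd p \<in> roots l"
    and q: "distinct q" "successively (\<lambda>x y. (x, y) \<in> E) q" "set q \<subseteq> set_tree r"
      "q \<noteq> [] \<Longrightarrow> hd q \<in> roots r"
    using root_pathsD[of E l p] root_pathsD[of E r q] assms by auto
  have "successively (\<lambda>x y. (y, x) \<in> E) p"
    using p(2) \<open>sym E\<close> by (auto elim: successively_mono dest: symD)
  moreover have "p \<noteq> [] \<Longrightarrow> (hd p, x) \<in> E"
    using p(4) assms(2) \<open>sym E\<close> by (auto dest: symD)
  moreover have "q \<noteq> [] \<Longrightarrow> (x, hd q) \<in> E"
    using q(4) assms(2) by auto
  ultimately have "successively (\<lambda>x y. (x, y) \<in> E) (rev p @ x # q)"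
    using q(2) by (auto simp: successively_append_iff successively_Cons last_rev)
  moreover have "distinct (rev p @ x # q)" using p q assms(2) by auto
  ultimately show ?thesis by (simp add: simple_path_def)
qed

section \<open>Ternary codes of leaf positions\<close>

text \<open>The argument \<open>e\<close> is the label accumulated above the tree. The increments 1
  and 2 are distinct and nonzero modulo 3, so a coordinate changed once reveals both the change and
  its direction.\<close>

fun leaf_codes :: "('a \<Rightarrow> 'c) \<Rightarrow> ('c \<Rightarrow> nat) \<Rightarrow> 'a tree \<Rightarrow> ('c \<Rightarrow> nat) set" where
  "leaf_codes f e \<langle>\<rangle> = {e}"
| "leaf_codes f e \<langle>l, x, r\<rangle> =
     leaf_codes f (e(f x := (e (f x) + 1) mod 3)) l \<union> leaf_codes f (e(f x := (e (f x) + 2) mod 3)) r"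

lemma finite_leaf_codes: "finite (leaf_codes f e t)"
  by (induction t arbitrary: e) auto

lemma leaf_codes_subset_PiE:
  assumes "f ` set_tree t \<subseteq> C" "e \<in> C \<rightarrow>\<^sub>E {..<3}"
  shows "leaf_codes f e t \<subseteq> C \<rightarrow>\<^sub>E {..<3}"
  using assms
proof (induction t arbitrary: e)
  case (Node l x r)
  have "e(f x := i mod 3) \<in> C \<rightarrow>\<^sub>E {..<3}" for i
    using Node.prems by (auto simp: PiE_iff extensional_def)
  then show ?case using Node.IH Node.prems(1) by (simp add: image_Un)
qed simp

lemma mod3_neq:
  assumes "(n::nat) < 3"
  shows "(n + 1) mod 3 \<noteq> n" "(n + 2) mod 3 \<noteq> n" "(n + 1) mod 3 \<noteq> (n + 2) mod 3"
  using assms by presburger+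

text \<open>Coordinate \<open>c\<close> changes only at vertices of color \<open>c\<close>, and a
  single change is never zero modulo 3. Several changes may cancel, hence nothing is claimed for
  larger counts.\<close>

lemma leaf_codes_root_path:
  assumes "g \<in> leaf_codes f e t" "\<forall>c\<in>f ` set_tree t. e c < 3"
  shows "\<exists>p\<in>root_paths t. \<forall>c. (count_list (map f p) c = 0 \<longrightarrow> g c = e c) \<and>
      (count_list (map f p) c = 1 \<longrightarrow> g c \<noteq> e c)"
  using assms
proof (induction t arbitrary: e)
  case (Node l x r)
  obtain t i where t: "t = l \<or> t = r" and i: "i \<in> {1, 2}"
    and g: "g \<in> leaf_codes f (e(f x := (e (f x) + i) mod 3)) t" (is "g \<in> leaf_codes f ?e t")
  proof -
    from Node.prems(1) consider
      "g \<in> leaf_codes f (e(f x := (e (f x) + 1) mod 3)) l"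
      | "g \<in> leaf_codes f (e(f x := (e (f x) + 2) mod 3)) r"
      by auto
    then show thesis using that by cases blast+
  qed
  have lt: "\<forall>c\<in>f ` set_tree t. ?e c < 3"
    using Node.prems(2) t by auto
  have "\<exists>p\<in>root_paths t. \<forall>c. (count_list (map f p) c = 0 \<longrightarrow> g c = ?e c) \<and>
      (count_list (map f p) c = 1 \<longrightarrow> g c \<noteq> ?e c)"
    using t
  proof
    assume "t = l"
    show ?thesis using g lt unfolding \<open>t = l\<close> by (rule Node.IH(1))
  next
    assume "t = r"
    show ?thesis using g lt unfolding \<open>t = r\<close> by (rule Node.IH(2))
  qed
  then obtain p where p: "p \<in> root_paths t"
    and count: "\<forall>c. (count_list (map f p) c = 0 \<longrightarrow> g c = ?e c) \<and>
      (count_list (map f p) c = 1 \<longrightarrow> g c \<noteq> ?e c)"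
    by (elim bexE)
  have neq: "?e (f x) \<noteq> e (f x)" using mod3_neq[of "e (f x)"] i Node.prems(2) by auto
  have "(count_list (map f (x # p)) c = 0 \<longrightarrow> g c = e c) \<and>
      (count_list (map f (x # p)) c = 1 \<longrightarrow> g c \<noteq> e c)" for c
    using count[THEN spec, of c] neq by (cases "c = f x") auto
  then show ?case using p t by (intro bexI[of _ "x # p"]) auto
qed simp

text \<open>The codes of the two subtrees are disjoint, so
  \<open>(size l + 1) + (size r + 1)\<close> codes arise at a node.\<close>

lemma card_leaf_codes:
  assumes "sym E"
    and unique: "\<And>p. simple_path E p \<Longrightarrow> set p \<subseteq> set_tree t \<Longrightarrow> \<exists>c. count_list (map f p) c = 1"
    and "binary_subtree E t" "\<forall>c\<in>f ` set_tree t. e c < 3"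
  shows "card (leaf_codes f e t) = size t + 1"
  using assms(2-)
proof (induction t arbitrary: e)
  case (Node l x r)
  let ?e = "\<lambda>i. e(f x := (e (f x) + i) mod 3)"
  have lt_l: "\<forall>c\<in>f ` set_tree l. ?e i c < 3" for i
    using Node.prems(3) by auto
  have lt_r: "\<forall>c\<in>f ` set_tree r. ?e i c < 3" for i
    using Node.prems(3) by auto
  have "False" if gl: "g \<in> leaf_codes f (?e 1) l" and gr: "g \<in> leaf_codes f (?e 2) r" for g
  proof -
    obtain p where p: "p \<in> root_paths l"
      and count_p: "\<forall>c. (count_list (map f p) c = 0 \<longrightarrow> g c = ?e 1 c) \<and>
        (count_list (map f p) c = 1 \<longrightarrow> g c \<noteq> ?e 1 c)"
      using leaf_codes_root_path[OF gl lt_l] by (elim bexE)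
    obtain q where q: "q \<in> root_paths r"
      and count_q: "\<forall>c. (count_list (map f q) c = 0 \<longrightarrow> g c = ?e 2 c) \<and>
        (count_list (map f q) c = 1 \<longrightarrow> g c \<noteq> ?e 2 c)"
      using leaf_codes_root_path[OF gr lt_r] by (elim bexE)
    have path: "simple_path E (rev p @ x # q)"
      using simple_path_through_root[OF \<open>sym E\<close> Node.prems(2) p q] .
    moreover have "set (rev p @ x # q) \<subseteq> set_tree \<langle>l, x, r\<rangle>"
      using root_pathsD(3)[OF _ p] root_pathsD(3)[OF _ q] Node.prems(2) by fastforce
    ultimately obtain c where "count_list (map f (rev p @ x # q)) c = 1"
      using Node.prems(1) by blast
    then have count: "count_list (map f p) c + (if f x = c then 1 else 0) + count_list (map f q) c = 1"
      by (simp add: rev_map[symmetric] split: if_splits)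
    show False
    \<comment> \<open>If the unique color is that of \<open>x\<close>, the common code would have
      both incremented values there. Otherwise \<open>c\<close> occurs on just one of the two sides,
      so the code both keeps and changes \<open>e c\<close>.\<close>
    proof (cases "f x = c")
      case True
      with count count_p[THEN spec, of c] count_q[THEN spec, of c] have "?e 1 c = ?e 2 c" by simp
      with True mod3_neq(3)[of "e c"] Node.prems(3) show False by simp
    next
      case False
      then show False using count count_p[THEN spec, of c] count_q[THEN spec, of c] by (auto simp: add_is_1)
    qed
  qed
  then have disj: "leaf_codes f (?e 1) l \<inter> leaf_codes f (?e 2) r = {}" by blast
  have "card (leaf_codes f (?e 1) l) = size l + 1"
  proof (rule Node.IH(1))
    show "\<exists>c. count_list (map f p) c = 1" if "simple_path E p" "set p \<subseteq> set_tree l" for p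
      using Node.prems(1) that by auto
  qed (use Node.prems(2) in simp, rule lt_l)
  moreover have "card (leaf_codes f (?e 2) r) = size r + 1"
  proof (rule Node.IH(2))
    show "\<exists>c. count_list (map f p) c = 1" if "simple_path E p" "set p \<subseteq> set_tree r" for p
      using Node.prems(1) that by auto
  qed (use Node.prems(2) in simp, rule lt_r)
  ultimately show ?case using disj by (simp add: card_Un_disjoint finite_leaf_codes)
qed simp

lemma size_binary_subtree_less:
  assumes "sym E" "binary_subtree E t" "finite C" "f ` set_tree t \<subseteq> C"
    and "\<And>p. simple_path E p \<Longrightarrow> set p \<subseteq> set_tree t \<Longrightarrow> \<exists>c. count_list (map f p) c = 1"
  shows "size t < 3 ^ card C"
proof -
  \<comment> \<open>The start label is zero on \<open>C\<close> and undefined elsewhere, as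
    membership in the extensional function space demands.\<close>
  define e :: "'b \<Rightarrow> nat" where "e = (\<lambda>c\<in>C. 0)"
  have "size t + 1 = card (leaf_codes f e t)"
    using assms by (intro card_leaf_codes[symmetric]) (auto simp: e_def)
  also have "\<dots> \<le> card (C \<rightarrow>\<^sub>E {..<3::nat})"
    using assms by (intro card_mono leaf_codes_subset_PiE finite_PiE) (auto simp: e_def)
  also have "\<dots> = 3 ^ card C" using \<open>finite C\<close> by (simp add: card_PiE)
  finally show ?thesis by simp
qed

section \<open>Branches at a vertex\<close>

section \<open>Heavy chains in trees\<close>

text \<open>For \<open>s\<close> in \<open>V - {r}\<close> this is the component of \<open>s\<close>
  after \<open>r\<close> is deleted from \<open>V\<close>.\<close>

definition branch :: "('a \<times> 'a) set \<Rightarrow> 'a set \<Rightarrow> 'a \<Rightarrow> 'a \<Rightarrow> 'a set" where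
  "branch E V r s = {y. (s, y) \<in> (E \<inter> (V - {r}) \<times> (V - {r}))\<^sup>*}"

lemma self_in_branch: "s \<in> branch E V r s"
  by (simp add: branch_def)

lemma branch_step:
  "y \<in> branch E V r s \<Longrightarrow> (y, z) \<in> E \<Longrightarrow> y \<in> V - {r} \<Longrightarrow> z \<in> V - {r} \<Longrightarrow> z \<in> branch E V r s"
  unfolding branch_def by (auto intro: rtrancl_into_rtrancl)

lemma branch_subset:
  assumes "s \<in> V - {r}"
  shows "branch E V r s \<subseteq> V - {r}"
proof
  fix y assume "y \<in> branch E V r s"
  then have "(s, y) \<in> (E \<inter> (V - {r}) \<times> (V - {r}))\<^sup>*" by (simp add: branch_def)
  then show "y \<in> V - {r}" by induction (use assms in auto)
qed

lemma connected_set_branch: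
  assumes "sym E"
  shows "connected_set E (branch E V r s)"
proof -
  let ?B = "branch E V r s"
  let ?R = "E \<inter> (V - {r}) \<times> (V - {r})"
  have from_s: "(s, y) \<in> (E \<inter> ?B \<times> ?B)\<^sup>*" if "y \<in> ?B" for y
  proof -
    have "(s, y) \<in> ?R\<^sup>*" using that by (simp add: branch_def)
    then show ?thesis
    proof induction
      case (step y z)
      then have "(s, z) \<in> ?R\<^sup>*" by (meson rtrancl_into_rtrancl)
      with step have "(y, z) \<in> E \<inter> ?B \<times> ?B" by (auto simp: branch_def)
      with step.IH show ?case by (rule rtrancl_into_rtrancl)
    qed simp
  qed
  have "sym (E \<inter> ?B \<times> ?B)" using assms by (auto simp: sym_def)
  then have "sym ((E \<inter> ?B \<times> ?B)\<^sup>*)" by (rule sym_rtrancl)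
  then have "(x, y) \<in> (E \<inter> ?B \<times> ?B)\<^sup>*" if "x \<in> ?B" "y \<in> ?B" for x y
    using from_s[OF that(1)] from_s[OF that(2)] by (meson rtrancl_trans symD)
  then show ?thesis unfolding connected_set_def using self_in_branch by fast
qed

lemma connected_set_eq_branches:
  assumes "connected_set E V" "r \<in> V" "(r, r) \<notin> E"
  shows "V = insert r (\<Union>s\<in>{s \<in> V. (r, s) \<in> E}. branch E V r s)" (is "_ = ?U")
proof
  have "z \<in> ?U" if "y \<in> ?U \<inter> V" "z \<in> V" "(y, z) \<in> E" for y z
  proof (cases "y = r \<or> z = r")
    case True
    then show ?thesis using that self_in_branch[of z E V r] by auto
  next
    case False
    then show ?thesis using that branch_step[of y E V r _ z] by auto
  qed
  then show "V \<subseteq> ?U"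
    using connected_set_closed_subset[of E V r ?U] assms by blast
  have "branch E V r s \<subseteq> V" if "s \<in> V" "(r, s) \<in> E" for s
    using that assms(3) branch_subset[of s V r E] by fastforce
  then show "?U \<subseteq> V" using assms(2) by blast
qed

text \<open>A common vertex yields a walk from \<open>s'\<close> to \<open>s\<close> avoiding
  \<open>r\<close>; preceded by the edge from \<open>r\<close> to \<open>s'\<close>, it bypasses the
  edge from \<open>r\<close> to \<open>s\<close>, which is a bridge.\<close>

lemma branches_disjoint:
  assumes "sym E" and bridge: "\<And>u v. (u, v) \<in> E \<Longrightarrow> (u, v) \<notin> (E - {(u, v), (v, u)})\<^sup>*"
    and "(r, s) \<in> E" "(r, s') \<in> E" "s \<noteq> s'"
  shows "branch E V r s \<inter> branch E V r s' = {}"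
proof (rule ccontr)
  let ?R = "E \<inter> (V - {r}) \<times> (V - {r})"
  assume "branch E V r s \<inter> branch E V r s' \<noteq> {}"
  then obtain y where "(s, y) \<in> ?R\<^sup>*" "(s', y) \<in> ?R\<^sup>*" by (auto simp: branch_def)
  moreover have "sym (?R\<^sup>*)" using \<open>sym E\<close> by (intro sym_rtrancl) (auto simp: sym_def)
  ultimately have "(s', s) \<in> ?R\<^sup>*" by (meson rtrancl_trans symD)
  moreover have "?R \<subseteq> E - {(r, s), (s, r)}" by auto
  ultimately have "(s', s) \<in> (E - {(r, s), (s, r)})\<^sup>*" using rtrancl_mono by blast
  \<comment> \<open>Taking both ends equal in \<open>bridge\<close> excludes loops, because the
    closure is reflexive.\<close>
  moreover have "(r, s') \<in> E - {(r, s), (s, r)}"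
    using assms(3-5) bridge[of r r] by auto
  ultimately have "(r, s) \<in> (E - {(r, s), (s, r)})\<^sup>*" by (meson converse_rtrancl_into_rtrancl)
  with bridge[OF \<open>(r, s) \<in> E\<close>] show False by blast
qed

section \<open>Construction of a heavy chain together with its binary subtree\<close>

text \<open>Couples the two bounds: the total weight of \<open>ds\<close> controls the number of
  ranks, and the equally large \<open>t\<close> forces many colors in a linear coloring.\<close>

definition heavy_chain ::
  "('a \<times> 'a) set \<Rightarrow> 'a set \<Rightarrow> 'a \<Rightarrow> ('a \<times> 'a set \<times> nat) list \<Rightarrow> 'a tree \<Rightarrow> bool" where
  "heavy_chain E V r ds t \<longleftrightarrow>
     chain E ds \<and> ds \<noteq> [] \<and> fst (hd ds) = r \<and> chain_verts ds = V \<and>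
     (\<forall>v A w. (v, A, w) \<in> set ds \<longrightarrow> 0 < w \<and> 2 * w \<le> Suc (chain_weight ds) \<and>
        quadratically_rankable E (A - {v}) w) \<and>
     binary_subtree E t \<and> roots t = {r} \<and> set_tree t \<subseteq> V \<and> size t = chain_weight ds"

lemma heavy_chain_rankable:
  assumes "sym E" "heavy_chain E V r ds t"
  shows "quadratically_rankable E V (Suc (size t))"
proof -
  have "quadratically_rankable E (chain_verts ds) (Suc (chain_weight ds))"
    using assms unfolding heavy_chain_def by (intro quadratically_rankable_chain) auto
  then show ?thesis using assms unfolding heavy_chain_def by simp
qed

text \<open>Induction on the size of \<open>V\<close>: the chain of the heaviest branch at
  \<open>r\<close> is extended by \<open>r\<close>, and the subtree of the second heaviest branch
  becomes the other child of \<open>r\<close>. The remaining branches are at most as heavy as the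
  second one.\<close>

lemma ex_heavy_chain:
  assumes "sym E" and bridge: "\<And>u v. (u, v) \<in> E \<Longrightarrow> (u, v) \<notin> (E - {(u, v), (v, u)})\<^sup>*"
    and "finite V" "connected_set E V" "r \<in> V"
  shows "\<exists>ds t. heavy_chain E V r ds t"
  using assms(3-)
proof (induction "card V" arbitrary: V r rule: less_induct)
  case less
  define K where "K = {s \<in> V. (r, s) \<in> E}"
  define U where "U = branch E V r"
  have irrefl: "(x, x) \<notin> E" for x using bridge[of x x] by auto
  have V: "V = insert r (\<Union>s\<in>K. U s)"
    using connected_set_eq_branches[OF less.prems(2,3) irrefl] by (simp add: K_def U_def)
  have K: "finite K" using less.prems(1) by (simp add: K_def)
  have KV: "s \<in> V - {r}" "(r, s) \<in> E" if "s \<in> K" for s using that irrefl by (auto simp: K_def)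
  have U_sub: "U s \<subseteq> V - {r}" if "s \<in> K" for s
    using branch_subset[OF KV(1)[OF that]] by (simp add: U_def)
  have U_self: "s \<in> U s" for s by (simp add: U_def self_in_branch)
  have U_disj: "U s \<inter> U s' = {}" if "s \<in> K" "s' \<in> K" "s \<noteq> s'" for s s'
    using branches_disjoint[OF assms(1,2)] KV that by (simp add: U_def)
  have U_sep: "(x, y) \<notin> E" if "s \<in> K" "s' \<in> K" "s \<noteq> s'" "x \<in> U s" "y \<in> U s'" for s s' x y
  proof
    assume "(x, y) \<in> E"
    then have "y \<in> U s"
      using branch_step[of x E V r s y] that U_sub by (auto simp: U_def)
    then show False using that U_disj by blast
  qed
  \<comment> \<open>Another neighbor of \<open>r\<close> in \<open>U s\<close> would also lie in its
    own branch, against disjointness.\<close>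
  have r_U: "y = s" if "s \<in> K" "y \<in> U s" "(r, y) \<in> E" for s y
  proof (rule ccontr)
    assume "y \<noteq> s"
    moreover have "y \<in> K" using that U_sub by (auto simp: K_def)
    ultimately show False using U_disj[of s y] U_self[of y] that by blast
  qed
  have "\<forall>s\<in>K. \<exists>ds t. heavy_chain E (U s) s ds t"
  proof
    fix s assume s: "s \<in> K"
    have "card (U s) < card V"
      using U_sub[OF s] less.prems(1,3) by (intro psubset_card_mono) auto
    then show "\<exists>ds t. heavy_chain E (U s) s ds t"
      using less.prems(1) U_sub[OF s] U_self connected_set_branch[OF \<open>sym E\<close>]
      by (intro less.hyps) (auto simp: U_def intro: finite_subset)
  qed
  then obtain D T where hc: "\<And>s. s \<in> K \<Longrightarrow> heavy_chain E (U s) s (D s) (T s)" by metis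
  show ?case
  proof (cases "K = {}")
    case True
    then have "V = {r}" using V by simp
    then have "heavy_chain E V r [(r, {r}, 1)] \<langle>\<langle>\<rangle>, r, \<langle>\<rangle>\<rangle>"
      by (simp add: heavy_chain_def quadratically_rankable_def rankable_empty)
    then show ?thesis by blast
  next
    case False
    have heaviest: "\<exists>h\<in>L. \<forall>s\<in>L. size (T s) \<le> size (T h)" if L: "L \<subseteq> K" "L \<noteq> {}" for L
    proof -
      have "finite L" using L(1) K by (rule finite_subset)
      then obtain h where h: "h \<in> L" "Max ((\<lambda>s. size (T s)) ` L) = size (T h)"
        using L(2) by (rule obtains_MAX)
      have "size (T s) \<le> size (T h)" if "s \<in> L" for s
        unfolding h(2)[symmetric] using \<open>finite L\<close> that by (intro Max_ge) auto
      with h(1) show ?thesis by blast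
    qed
    obtain h where h: "h \<in> K" "\<And>s. s \<in> K \<Longrightarrow> size (T s) \<le> size (T h)"
      using heaviest[of K] False by blast
    define K' where "K' = K - {h}"
    \<comment> \<open>The tree of the second heaviest branch, or the empty tree if \<open>h\<close>
      is the only neighbor.\<close>
    obtain t where t: "binary_subtree E t" "roots t \<subseteq> K'" "set_tree t \<subseteq> (\<Union>s\<in>K'. U s)"
      "size t \<le> size (T h)" "\<And>s. s \<in> K' \<Longrightarrow> size (T s) \<le> size t"
    proof (cases "K' = {}")
      case True
      then show thesis using that[of "\<langle>\<rangle>"] by simp
    next
      case False
      then obtain l where l: "l \<in> K'" "\<And>s. s \<in> K' \<Longrightarrow> size (T s) \<le> size (T l)"
        using heaviest[of K'] by (auto simp: K'_def)
      then have "l \<in> K" by (simp add: K'_def)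
      then have Tl: "binary_subtree E (T l)" "roots (T l) = {l}" "set_tree (T l) \<subseteq> U l"
        using hc[of l] by (simp_all add: heavy_chain_def)
      show thesis
        by (rule that[of "T l"]) (use Tl l h(2) \<open>l \<in> K\<close> in auto)
    qed
    let ?A = "insert r (\<Union>s\<in>K'. U s)"
    \<comment> \<open>Weight \<open>Suc (size t)\<close> covers every lighter branch and adds up to
      the size of the new tree. That \<open>t\<close> is at most as large as \<open>T h\<close>
      keeps its double below the permitted total plus one.\<close>
    let ?ds = "(r, ?A, Suc (size t)) # D h"
    have H: "chain E (D h)" "D h \<noteq> []" "fst (hd (D h)) = h" "chain_verts (D h) = U h"
      "binary_subtree E (T h)" "roots (T h) = {h}" "set_tree (T h) \<subseteq> U h"
      "size (T h) = chain_weight (D h)"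
      "\<And>v A w. (v, A, w) \<in> set (D h) \<Longrightarrow> 0 < w \<and> 2 * w \<le> Suc (chain_weight (D h)) \<and>
        quadratically_rankable E (A - {v}) w"
      using hc[OF h(1)] unfolding heavy_chain_def by auto
    have K': "s \<in> K" "s \<noteq> h" if "s \<in> K'" for s using that by (auto simp: K'_def)
    have r: "r \<notin> U s" if "s \<in> K" for s using U_sub[OF that] by auto
    have disj: "(\<Union>s\<in>K'. U s) \<inter> U h = {}" using U_disj K' h(1) by blast
    have "rankable E (\<Union>s\<in>K'. U s) n" if n: "(Suc (size t))\<^sup>2 < 2 ^ Suc n" for n
    proof (rule rankable_UN)
      fix s assume s: "s \<in> K'"
      have "quadratically_rankable E (U s) (Suc (size t))"
        using heavy_chain_rankable[OF \<open>sym E\<close> hc[OF K'(1)[OF s]]] t(5)[OF s]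
        by (rule quadratically_rankable_mono[OF _ Suc_leI[OF le_imp_less_Suc]])
      then show "rankable E (U s) n" using n by (simp add: quadratically_rankable_def)
    next
      fix s s' assume s: "s \<in> K'" "s' \<in> K'" "s \<noteq> s'"
      show "U s \<inter> U s' = {}" by (rule U_disj[OF K'(1)[OF s(1)] K'(1)[OF s(2)] s(3)])
      show "(x, y) \<notin> E" if "x \<in> U s" "y \<in> U s'" for x y
        by (rule U_sep[OF K'(1)[OF s(1)] K'(1)[OF s(2)] s(3) that])
    qed
    then have "quadratically_rankable E (\<Union>s\<in>K'. U s) (Suc (size t))"
      by (simp add: quadratically_rankable_def)
    moreover have "?A - {r} = (\<Union>s\<in>K'. U s)" using r K' by auto
    ultimately have rank: "quadratically_rankable E (?A - {r}) (Suc (size t))" by simp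
    have entries: "0 < w \<and> 2 * w \<le> Suc (chain_weight ?ds) \<and> quadratically_rankable E (A - {v}) w"
      if "(v, A, w) \<in> set ?ds" for v A w
    proof (cases "(v, A, w) \<in> set (D h)")
      case True
      then show ?thesis using H(9)[OF True] by simp
    next
      case False
      then have "v = r" "A = ?A" "w = Suc (size t)" using that by auto
      then show ?thesis using rank t(4) H(8) by simp
    qed
    have "x = r \<and> y = h" if xy: "x \<in> ?A" "y \<in> U h" "(x, y) \<in> E" for x y
    proof (cases "x = r")
      case True
      then show ?thesis using r_U[OF h(1)] xy by simp
    next
      case False
      then obtain s where s: "s \<in> K'" "x \<in> U s" using xy(1) by blast
      then show ?thesis using U_sep[OF K'(1)[OF s(1)] h(1) K'(2)[OF s(1)] s(2) xy(2)] xy(3) by simp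
    qed
    then have "chain E ?ds"
      using H(1-4) r[OF h(1)] disj by auto
    moreover have "chain_verts ?ds = V"
    proof -
      have "K = insert h K'" using h(1) by (auto simp: K'_def)
      then show ?thesis by (subst V) (auto simp: H(4))
    qed
    moreover have "binary_subtree E \<langle>T h, r, t\<rangle>"
    proof -
      have "r \<notin> set_tree (T h)" using H(7) r[OF h(1)] by blast
      moreover have "r \<notin> set_tree t" using t(3) r K'(1) by blast
      moreover have "set_tree (T h) \<inter> set_tree t = {}" using t(3) H(7) disj by blast
      moreover have "\<forall>y\<in>roots (T h) \<union> roots t. (r, y) \<in> E"
        using H(6) t(2) KV(2) K'(1) h(1) by auto
      ultimately show ?thesis using t(1) H(5) by simp
    qed
    moreover have "set_tree \<langle>T h, r, t\<rangle> \<subseteq> V"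
    proof -
      have "set_tree (T h) \<subseteq> V" using H(7) U_sub[OF h(1)] by blast
      moreover have "set_tree t \<subseteq> V" using t(3) U_sub K'(1) by blast
      ultimately show ?thesis using less.prems(3) by simp
    qed
    moreover have "\<forall>v A w. (v, A, w) \<in> set ?ds \<longrightarrow>
        0 < w \<and> 2 * w \<le> Suc (chain_weight ?ds) \<and> quadratically_rankable E (A - {v}) w"
      using entries by blast
    ultimately have "heavy_chain E V r ?ds \<langle>T h, r, t\<rangle>"
      unfolding heavy_chain_def using H(8) by simp
    then show ?thesis by blast
  qed
qed

section \<open>Paths, bridges and connectivity in the graph encoding\<close>

section \<open>Undirected trees\<close>

text \<open>When the new start already lies on the path, the path is cut to its suffix from that
  vertex.\<close>

lemma rtrancl_simple_path:
  assumes "(x, y) \<in> R\<^sup>*"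
  obtains p where "simple_path R p" "hd p = x" "last p = y"
proof -
  have "\<exists>p. simple_path R p \<and> hd p = x \<and> last p = y"
    using assms
  proof (induction rule: converse_rtrancl_induct)
    case base
    then show ?case by (intro exI[of _ "[y]"]) (simp add: simple_path_def)
  next
    case (step x z)
    then obtain p where p: "simple_path R p" "hd p = z" "last p = y" by blast
    show ?case
    proof (cases "x \<in> set p")
      case True
      then obtain as bs where "p = as @ x # bs" by (meson split_list)
      with p show ?thesis
        by (intro exI[of _ "x # bs"]) (auto simp: simple_path_def successively_append_iff)
    next
      case False
      with p step.hyps show ?thesis
        by (intro exI[of _ "x # p"]) (auto simp: simple_path_def successively_Cons)
    qed
  qed
  then show thesis using that by blast
qed

text \<open>Walks are arc lists here, and \<open>zip p (tl p)\<close> lists the consecutive arcs.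
  For a single vertex it is empty, so membership of \<open>hd p\<close> has to be assumed.\<close>

lemma apath_of_simple_path:
  assumes "pair_wf_digraph G" "simple_path (parcs G) p" "hd p \<in> pverts G"
  shows "pre_digraph.apath G (hd p) (zip p (tl p)) (last p)"
    "pre_digraph.awalk_verts G (hd p) (zip p (tl p)) = p"
proof -
  interpret pair_wf_digraph G by fact
  have "awalk (hd p) (zip p (tl p)) (last p) \<and> pawalk_verts (hd p) (zip p (tl p)) = p"
    using assms(2,3)
  proof (induction p)
    case (Cons x p)
    then show ?case
    proof (cases p)
      case Nil
      then show ?thesis using Cons.prems by (simp add: awalk_Nil_iff)
    next
      case (Cons y q)
      then show ?thesis using Cons.IH Cons.prems
        by (auto simp: simple_path_def awalk_Cons_iff dest: in_arcsD2)
    qed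
  qed (simp add: simple_path_def)
  then show "apath (hd p) (zip p (tl p)) (last p)"
    "pre_digraph.awalk_verts G (hd p) (zip p (tl p)) = p"
    using assms(2) by (auto simp: apath_def simple_path_def)
qed

lemma linear_coloring_simple_path:
  assumes "pair_wf_digraph G" "linear_coloring G f" "simple_path (parcs G) p" "hd p \<in> pverts G"
  shows "\<exists>c. count_list (map f p) c = 1"
proof -
  have "has_unique_color f (set p)"
    using assms(2)[unfolded linear_coloring_def, rule_format,
        OF apath_of_simple_path(1)[OF assms(1,3,4)]]
    unfolding apath_of_simple_path(2)[OF assms(1,3,4)] .
  then obtain v where v: "v \<in> set p" "\<forall>w\<in>set p. f w = f v \<longrightarrow> w = v"
    unfolding has_unique_color_def by (elim bexE)
  from split_list[OF v(1)] obtain as bs where p: "p = as @ v # bs" by blast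
  moreover have "v \<notin> set as \<union> set bs" using assms(3) p by (auto simp: simple_path_def)
  ultimately have "f v \<notin> f ` (set as \<union> set bs)" using v(2) by auto
  then have "count_list (map f p) (f v) = 1" by (auto simp: p count_list_0_iff)
  then show ?thesis by blast
qed

text \<open>A path from \<open>u\<close> to \<open>v\<close> avoiding the edge would close up with
  the arc \<open>(v, u)\<close> to a cycle.\<close>

lemma undirected_tree_bridge:
  assumes "undirected_tree T" "(u, v) \<in> parcs T"
  shows "(u, v) \<notin> (parcs T - {(u, v), (v, u)})\<^sup>*" (is "_ \<notin> ?R\<^sup>*")
proof
  interpret pair_graph T using assms(1) by (simp add: undirected_tree_def)
  assume "(u, v) \<in> ?R\<^sup>*"
  then obtain p where p: "simple_path ?R p" "hd p = u" "last p = v" by (rule rtrancl_simple_path)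
  have uv: "u \<noteq> v" "(v, u) \<in> parcs T" "u \<in> pverts T"
    using assms(2) no_loops' arcs_symmetric in_arcsD1 by auto
  \<comment> \<open>One vertex would give \<open>u = v\<close>, and two would use the removed arc;
    so the cycle is not a mere pair of opposite arcs.\<close>
  have "3 \<le> length p"
  proof (rule ccontr)
    assume "\<not> 3 \<le> length p"
    then consider "p = []" | a where "p = [a]" | a b where "p = [a, b]"
      by (cases p rule: remdups_adj.cases) (auto simp: Suc_le_eq)
    then show False using p uv by cases (auto simp: simple_path_def)
  qed
  have path: "simple_path (parcs T) p"
    using p(1) by (auto simp: simple_path_def elim: successively_mono)
  have "apath u (zip p (tl p)) v" "pawalk_verts u (zip p (tl p)) = p"
    using apath_of_simple_path[OF pair_wf_digraph path] p uv by auto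
  then have "cycle ((v, u) # zip p (tl p))"
    using uv path in_arcsD1[OF uv(2)]
    by (auto simp: cycle_def awalk_Cons_iff apath_def simple_path_def)
  moreover have "3 \<le> length ((v, u) # zip p (tl p))" using \<open>3 \<le> length p\<close> by auto
  ultimately show False using assms(1) unfolding undirected_tree_def by blast
qed

text \<open>Symmetry of the arcs turns connectedness into strong connectedness. A larger
  \<open>E\<close> is allowed so that the lemma covers subgraphs that are not induced.\<close>

lemma connected_set_pverts:
  assumes "pair_graph H" "connected H" "parcs H \<subseteq> E"
  shows "connected_set E (pverts H)"
proof -
  interpret pair_graph H by fact
  have sc: "strongly_connected H"
    using symmetric_connected_imp_strongly_connected assms(2) sym_arcs by blast
  have "(u, v) \<in> (E \<inter> pverts H \<times> pverts H)\<^sup>*" if "u \<in> pverts H" "v \<in> pverts H" for u v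
  proof -
    have "(u, v) \<in> rtrancl_on (pverts H) (parcs H)"
      using sc that by (auto simp: strongly_connected_def reachable_def)
    then show ?thesis
    proof (induction rule: rtrancl_on_induct)
      case (step a b)
      then have "(a, b) \<in> E \<inter> pverts H \<times> pverts H" using assms(3) in_arcsD1 in_arcsD2 by auto
      with step.IH show ?case by (rule rtrancl_into_rtrancl)
    qed simp
  qed
  then show ?thesis using sc by (auto simp: connected_set_def strongly_connected_def)
qed

section \<open>From rankings and linear colorings to the two chromatic numbers\<close>

lemma chi_cen_le:
  assumes "pair_graph G" "rankable (parcs G) (pverts G) n"
  shows "chi_cen G \<le> n"
proof -
  obtain f where f: "\<forall>v\<in>pverts G. f v < n"
    and uniq: "\<forall>W. W \<subseteq> pverts G \<and> connected_set (parcs G) W \<longrightarrow>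
      (\<exists>v\<in>W. \<forall>w\<in>W. w \<noteq> v \<longrightarrow> f w < f v)"
    using assms(2) unfolding rankable_def by (elim exE conjE)
  let ?f = "\<lambda>v. int (f v)"
  have "centered_coloring G ?f"
    unfolding centered_coloring_def
  proof (intro allI impI)
    fix H :: "'a pair_pre_digraph"
    assume H: "pair_graph H \<and> subgraph H G \<and> connected H"
    then have "pverts H \<subseteq> pverts G" "parcs H \<subseteq> parcs G" by (auto simp: subgraph_def)
    moreover have "connected_set (parcs G) (pverts H)"
      using H \<open>parcs H \<subseteq> parcs G\<close> connected_set_pverts by blast
    ultimately obtain v where v: "v \<in> pverts H" "\<forall>w\<in>pverts H. w \<noteq> v \<longrightarrow> f w < f v"
      using uniq[THEN spec, of "pverts H"] by (elim impE bexE) simp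
    have "w = v" if "w \<in> pverts H" "?f w = ?f v" for w
      using v(2)[THEN bspec, OF that(1)] that(2) by auto
    with v(1) show "has_unique_color ?f (pverts H)"
      unfolding has_unique_color_def by (intro bexI[of _ v] ballI impI)
  qed
  then have "chi_cen G \<le> card (?f ` pverts G)" unfolding chi_cen_def by (intro Least_le) blast
  also have "\<dots> \<le> card (int ` {..<n})" using f by (intro card_mono) auto
  also have "\<dots> = n" by (simp add: card_image)
  finally show ?thesis .
qed

text \<open>An injective coloring is linear, so the minimum ranges over a nonempty set.\<close>

lemma chi_lin_attained:
  assumes "pair_graph G"
  obtains f where "linear_coloring G f" "card (f ` pverts G) = chi_lin G"
proof -
  interpret pair_graph G by fact
  obtain g :: "'a \<Rightarrow> nat" where g: "inj_on g (pverts G)"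
    using finite_imp_inj_to_nat_seg[OF pair_finite_verts] by blast
  have "linear_coloring G (\<lambda>v. int (g v))"
    unfolding linear_coloring_def
  proof (intro allI impI)
    fix u p v assume "apath u p v"
    then have "set (pawalk_verts u p) \<subseteq> pverts G" "u \<in> set (pawalk_verts u p)"
      using hd_in_awalk_verts(2) by (auto simp: apath_def)
    then have "has_unique_color (\<lambda>v. int (g v)) (set (pawalk_verts u p))"
      using g unfolding has_unique_color_def inj_on_def by (intro bexI[of _ u]) auto
    then show "has_unique_color (\<lambda>v. int (g v)) (set (pre_digraph.awalk_verts G u p))" by simp
  qed
  then have "\<exists>k f. linear_coloring G f \<and> card (f ` pverts G) = k" by blast
  then have "\<exists>f. linear_coloring G f \<and> card (f ` pverts G) = chi_lin G"
    unfolding chi_lin_def by (rule LeastI_ex)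
  then show thesis using that by blast
qed

text \<open>With \<open>k = chi_lin T\<close>, the binary subtree of the heavy chain has size below
  \<open>3 ^ k\<close>; squaring produces \<open>9 ^ k\<close>.\<close>

lemma tree_rankable:
  assumes "undirected_tree T" "9 ^ chi_lin T < (2::nat) ^ Suc n"
  shows "rankable (parcs T) (pverts T) n"
proof -
  interpret pair_graph T using assms(1) by (simp add: undirected_tree_def)
  have symE: "sym (parcs T)" using arcs_symmetric by (auto simp: sym_def)
  have conn: "connected_set (parcs T) (pverts T)"
    using assms(1) by (intro connected_set_pverts) (auto simp: undirected_tree_def)
  then obtain r where "r \<in> pverts T" by (auto simp: connected_set_def)
  then obtain ds t where hc: "heavy_chain (parcs T) (pverts T) r ds t"
    using ex_heavy_chain[OF symE undirected_tree_bridge[OF assms(1)] pair_finite_verts conn] by blast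
  obtain f where f: "linear_coloring T f" "card (f ` pverts T) = chi_lin T"
    using pair_graph by (rule chi_lin_attained)
  have t: "binary_subtree (parcs T) t" "set_tree t \<subseteq> pverts T"
    using hc by (auto simp: heavy_chain_def)
  have "size t < 3 ^ card (f ` pverts T)"
  proof (intro size_binary_subtree_less[OF symE t(1)])
    fix p assume p: "simple_path (parcs T) p" "set p \<subseteq> set_tree t"
    then have "hd p \<in> pverts T" using t(2) by (auto simp: simple_path_def dest!: hd_in_set)
    then show "\<exists>c. count_list (map f p) c = 1"
      using linear_coloring_simple_path[OF pair_wf_digraph f(1) p(1)] by blast
  qed (use t(2) pair_finite_verts in auto)
  then have "(Suc (size t))\<^sup>2 \<le> (3 ^ chi_lin T)\<^sup>2"
    using f(2) by (intro power_mono) auto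
  also have "\<dots> = 9 ^ chi_lin T" by (simp add: power2_eq_square flip: power_mult_distrib)
  also note assms(2)
  finally show ?thesis
    using heavy_chain_rankable[OF symE hc] by (simp add: quadratically_rankable_def)
qed

section \<open>Numerical bounds on the constant\<close>

text \<open>The upper bound is \<open>3 ^ 5 = 243 \<le> 256 = 2 ^ 8\<close>.\<close>

lemma log2_3_bounds: "0 < log 2 3" "log 2 3 \<le> 8 / (5::real)"
proof -
  have "5 * log 2 3 = log 2 ((3::real) ^ 5)" by (subst log_nat_power) auto
  also have "\<dots> \<le> log 2 (2 ^ 8)" by (subst log_le_cancel_iff) auto
  also have "\<dots> = (8::real)" by (subst log_nat_power) auto
  finally show "log 2 3 \<le> 8 / (5::real)" by simp
qed simp

text \<open>Powers of \<phi> are linear in \<phi> with Fibonacci coefficients: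
  \<open>233 * \<phi> + 144\<close> exceeds \<open>2 ^ 9\<close>, and \<open>\<phi> + 1\<close> is
  below 3.\<close>

lemma log2_golden_bounds:
  defines "\<phi> \<equiv> (1 + sqrt 5) / 2"
  shows "9 / 13 \<le> log 2 \<phi>" "2 * log 2 \<phi> \<le> log 2 3"
proof -
  have "2.236 < sqrt 5" by (rule real_less_rsqrt) (simp add: power2_eq_square)
  moreover have "sqrt 5 < 3" by (rule real_less_lsqrt) simp_all
  ultimately have bounds: "1.618 < \<phi>" "\<phi> < 2" by (simp_all add: \<phi>_def)
  then have pos: "\<phi> > 0" by simp
  have sq: "\<phi> ^ 2 = \<phi> + 1" by (simp add: \<phi>_def power2_eq_square field_simps)
  have p4: "\<phi> ^ 4 = 3 * \<phi> + 2"
  proof -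
    have "\<phi> ^ 4 = (\<phi> ^ 2) ^ 2" by (simp flip: power_mult)
    also have "\<dots> = \<phi> ^ 2 + 2 * \<phi> + 1" by (simp add: sq power2_sum)
    finally show ?thesis by (simp add: sq)
  qed
  have p12: "\<phi> ^ 12 = 144 * \<phi> + 89"
  proof -
    have "\<phi> ^ 12 = (\<phi> ^ 4) ^ 2 * \<phi> ^ 4" by (simp flip: power_mult power_add)
    also have "(\<phi> ^ 4) ^ 2 = 9 * \<phi> ^ 2 + 12 * \<phi> + 4"
      by (simp add: p4 power2_sum power_mult_distrib)
    also have "\<dots> = 21 * \<phi> + 13" by (simp add: sq)
    also have "(21 * \<phi> + 13) * \<phi> ^ 4 = 63 * \<phi> ^ 2 + 81 * \<phi> + 26"
      by (simp add: p4 algebra_simps power2_eq_square)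
    finally show ?thesis by (simp add: sq)
  qed
  have p13: "\<phi> ^ 13 = 233 * \<phi> + 144"
  proof -
    have "\<phi> ^ 13 = \<phi> ^ 12 * \<phi>" by (simp flip: power_Suc2)
    also have "\<dots> = 144 * \<phi> ^ 2 + 89 * \<phi>" by (simp add: p12 algebra_simps power2_eq_square)
    finally show ?thesis by (simp add: sq)
  qed
  have "(9::real) = log 2 (2 ^ 9)" by (subst log_nat_power) auto
  also have "\<dots> \<le> log 2 (\<phi> ^ 13)"
    using pos bounds(1) by (subst log_le_cancel_iff) (auto simp: p13)
  also have "\<dots> = 13 * log 2 \<phi>" using pos by (subst log_nat_power) auto
  finally show "9 / 13 \<le> log 2 \<phi>" by simp
  have "2 * log 2 \<phi> = log 2 (\<phi> ^ 2)" using pos by (subst log_nat_power) auto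
  also have "\<dots> \<le> log 2 3"
    using pos bounds(2) by (subst log_le_cancel_iff) (auto simp: sq)
  finally show "2 * log 2 \<phi> \<le> log 2 3" .
qed

text \<open>The upper bound is the exact value \<open>(8 / 5)^2 * 13 / 9 = 832 / 225\<close>, about
  3.698; the fractions must be this sharp.\<close>

lemma c_tree_bounds: "2 * log 2 3 \<le> c_tree" "c_tree < 3.7"
proof -
  let ?l = "log 2 ((1 + sqrt 5) / 2)"
  have l: "9 / 13 \<le> ?l" "2 * ?l \<le> log 2 3" by (rule log2_golden_bounds)+
  have "2 \<le> alpha" unfolding alpha_def using l by (simp add: le_divide_eq)
  then show "2 * log 2 3 \<le> c_tree"
    unfolding c_tree_def using log2_3_bounds by (intro mult_right_mono) auto
  have "alpha \<le> (8 / 5) / (9 / 13)"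
    unfolding alpha_def using l log2_3_bounds by (intro frac_le) auto
  then have "c_tree \<le> (8 / 5) / (9 / 13) * (8 / 5)"
    unfolding c_tree_def using log2_3_bounds by (intro mult_mono) auto
  then show "c_tree < 3.7" by simp
qed

theorem theorem3p12:
  fixes T :: "'a pair_pre_digraph"
  assumes "undirected_tree T"
  shows "real (chi_cen T) \<le> c_tree * real (chi_lin T) \<and> c_tree < 3.7"
proof
  let ?k = "chi_lin T"
  \<comment> \<open>The largest \<open>n\<close> with \<open>2 ^ n \<le> 9 ^ ?k\<close>, that is,
    \<open>2 * log 2 3 * ?k\<close> rounded down.\<close>
  define n where "n = nat \<lfloor>log 2 (9 ^ ?k)\<rfloor>"
  have log: "log 2 (9 ^ ?k) = 2 * log 2 3 * real ?k"
  proof -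
    have "(9::real) ^ ?k = 3 ^ (2 * ?k)" by (simp add: power_mult)
    then show ?thesis by (simp add: log_nat_power)
  qed
  have n: "real n \<le> log 2 (9 ^ ?k)" "log 2 (9 ^ ?k) < real (Suc n)"
    using log2_3_bounds(1) unfolding n_def log by (auto simp: of_nat_nat) linarith+
  have "log 2 (9 ^ ?k) < log 2 (2 ^ Suc n)"
    using n(2) by (subst (2) log_nat_power) auto
  then have "(9::real) ^ ?k < 2 ^ Suc n" by (subst (asm) log_less_cancel_iff) auto
  then have "real (9 ^ ?k) < real (2 ^ Suc n)" by simp
  then have "9 ^ ?k < (2::nat) ^ Suc n" by (simp only: of_nat_less_iff)
  then have "chi_cen T \<le> n"
    using assms tree_rankable by (intro chi_cen_le) (auto simp: undirected_tree_def)
  then have "real (chi_cen T) \<le> 2 * log 2 3 * real ?k" using n(1) log by linarith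
  also have "\<dots> \<le> c_tree * real ?k" by (intro mult_right_mono c_tree_bounds) simp
  finally show "real (chi_cen T) \<le> c_tree * real ?k" .
  show "c_tree < 3.7" by (rule c_tree_bounds)
qed

end
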